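(* Let $D$ be a compact metric space with metric $d$, $\lambda$ a Radon measure on $D$ and $\mu>0$, and let $\tilde\Pi$ be the function on finite subsets of $D\times\{\mathtt R,\mathtt B\}$ defined in the context. For any two finite subsets $\xi=(\xi^{\mathtt R},\xi^{\mathtt B})$ and $\gamma=(\gamma^{\mathtt R},\gamma^{\mathtt B})$ of $D\times\{\mathtt R,\mathtt B\}$ (split into their red and blue points), $$\tilde\Pi(\xi\vee\gamma)\,\tilde\Pi(\xi\wedge\gamma)\ \ge\ \tilde\Pi(\xi)\,\tilde\Pi(\gamma),$$ where $\xi\vee\gamma=(\xi^{\mathtt R}\cup\gamma^{\mathtt R},\,\xi^{\mathtt B}\cap\gamma^{\mathtt B})$ and $\xi\wedge\gamma=(\xi^{\mathtt R}\cap\gamma^{\mathtt R},\,\xi^{\mathtt B}\cup\gamma^{\mathtt B})$.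
   Context: $\mathbf C=\{\mathtt R,\mathtt B\}$, with $\bar{\mathtt R}=\mathtt B$, $\bar{\mathtt B}=\mathtt R$. $\bar\lambda=\lambda\otimes m_c$ on $D\times\mathbf C$, $m_c$ = counting measure on $\mathbf C$. For $x=(p_x,c_x)\in D\times\mathbf C$, $N(x)=\{y\in D\times\mathbf C:c_y=\bar c_x,\ d(p_x,p_y)<1\}$, $N(A)=\bigcup_{x\in A}N(x)$. For a finite set $\{x_1,\dots,x_n\}\subset D\times\mathbf C$ of $n$ distinct points, $$\tilde\Pi(\{x_1,\dots,x_n\})=\sum_{(X_1,\dots,X_n)}\ \prod_{i=1}^n\frac{1}{\bar\lambda(N(\{X_1,\dots,X_i\}))+i\mu},$$ the sum being over all orderings $(X_1,\dots,X_n)$ of $x_1,\dots,x_n$; $\tilde\Pi(\emptyset)=1$. *)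

theory Defs
  imports "HOL-Analysis.Analysis" "HOL-Combinatorics.Multiset_Permutations"
begin

datatype colour = Red | Blue

fun opp :: "colour \<Rightarrow> colour" where
  "opp Red = Blue"
| "opp Blue = Red"

text \<open>
  A Radon measure on a Hausdorff space: a Borel measure that is locally finite and inner
  regular with respect to compact sets. On a compact metric space this amounts to a finite
  Borel measure. The first condition also forces \<open>space m = topspace X\<close>.
\<close>

definition radon_measure :: "'a topology \<Rightarrow> 'a measure \<Rightarrow> bool" where
  "radon_measure X m \<longleftrightarrow>
     sets m = sigma_sets (topspace X) {U. openin X U} \<and>
     (\<forall>x\<in>topspace X. \<exists>U. openin X U \<and> x \<in> U \<and> emeasure m U < \<infinity>) \<and>
     (\<forall>A\<in>sets m. emeasure m A = (SUP K\<in>{K. K \<in> sets m \<and> K \<subseteq> A \<and> compactin X K}. emeasure m K))"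

definition coloured_measure :: "'a measure \<Rightarrow> ('a \<times> colour) measure" where
  "coloured_measure m = m \<Otimes>\<^sub>M count_space UNIV"

definition nbhd :: "'a set \<Rightarrow> ('a \<Rightarrow> 'a \<Rightarrow> real) \<Rightarrow> 'a \<times> colour \<Rightarrow> ('a \<times> colour) set" where
  "nbhd D d x = {y \<in> D \<times> UNIV. snd y = opp (snd x) \<and> d (fst x) (fst y) < 1}"

definition nbhds :: "'a set \<Rightarrow> ('a \<Rightarrow> 'a \<Rightarrow> real) \<Rightarrow> ('a \<times> colour) set \<Rightarrow> ('a \<times> colour) set" where
  "nbhds D d A = (\<Union>x\<in>A. nbhd D d x)"

text \<open>
  An ordering \<open>(X\<^sub>1, \<dots>, X\<^sub>n)\<close> of a finite set is a distinct list \<open>xs\<close> enumerating it, and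
  \<open>{X\<^sub>1, \<dots>, X\<^sub>i}\<close> is \<open>set (take i xs)\<close>. The real-valued \<open>measure\<close> is harmless here,
  because a Radon measure on a compact space is finite.
\<close>

definition Pi_tilde ::
  "'a set \<Rightarrow> ('a \<Rightarrow> 'a \<Rightarrow> real) \<Rightarrow> 'a measure \<Rightarrow> real \<Rightarrow> ('a \<times> colour) set \<Rightarrow> real" where
  "Pi_tilde D d m \<mu> \<xi> =
     (\<Sum>xs\<in>permutations_of_set \<xi>. \<Prod>i=1..card \<xi>.
        1 / (measure (coloured_measure m) (nbhds D d (set (take i xs))) + real i * \<mu>))"

definition points_of_colour :: "colour \<Rightarrow> ('a \<times> colour) set \<Rightarrow> ('a \<times> colour) set" where
  "points_of_colour c \<xi> = {x \<in> \<xi>. snd x = c}"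

definition config_join :: "('a \<times> colour) set \<Rightarrow> ('a \<times> colour) set \<Rightarrow> ('a \<times> colour) set" where
  "config_join \<xi> \<gamma> =
     (points_of_colour Red \<xi> \<union> points_of_colour Red \<gamma>) \<union>
     (points_of_colour Blue \<xi> \<inter> points_of_colour Blue \<gamma>)"

definition config_meet :: "('a \<times> colour) set \<Rightarrow> ('a \<times> colour) set \<Rightarrow> ('a \<times> colour) set" where
  "config_meet \<xi> \<gamma> =
     (points_of_colour Red \<xi> \<inter> points_of_colour Red \<gamma>) \<union>
     (points_of_colour Blue \<xi> \<union> points_of_colour Blue \<gamma>)"

end

theory Submission
  imports Defs
begin

text \<open>
  Write \<open>f A\<close> for the rate \<open>\<lambda>(N(A)) + \<mu>|A|\<close>; it is submodular, and additive over the two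
  colours because red and blue points have disjoint neighbourhoods. Splitting off the last point
  of an ordering gives \<open>f A * \<Pi> A = (\<Sum>a\<in>A. \<Pi> (A - {a}))\<close>. This recursion shows by induction
  that \<open>\<Pi>\<close> is the product of its values on the red and on the blue part, so it suffices that
  \<open>\<Pi>\<close> is log-supermodular for set inclusion. By the usual telescoping this reduces to
  \<open>\<Pi> (A + x) * \<Pi> (A + y) \<le> \<Pi> (A + x + y) * \<Pi> A\<close>, which follows by induction on \<open>A\<close>
  from the recursion at \<open>A\<close>, \<open>A + x\<close>, \<open>A + y\<close> and \<open>A + x + y\<close> and submodularity of \<open>f\<close>.
\<close>

section \<open>Ordering sums and the recursion on the last point\<close>

definition ordering_weight :: "('a set \<Rightarrow> real) \<Rightarrow> 'a set \<Rightarrow> real" where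
  "ordering_weight f A =
     (\<Sum>xs\<in>permutations_of_set A. \<Prod>i=1..card A. 1 / f (set (take i xs)))"

lemma permutations_of_set_snoc:
  assumes "A \<noteq> {}"
  shows "permutations_of_set A = (\<Union>x\<in>A. (\<lambda>xs. xs @ [x]) ` permutations_of_set (A - {x}))"
proof (intro equalityI subsetI)
  fix xs assume xs: "xs \<in> permutations_of_set A"
  with assms have "xs \<noteq> []" by (auto simp: permutations_of_set_def)
  then obtain ys x where "xs = ys @ [x]" by (metis append_butlast_last_id)
  with xs show "xs \<in> (\<Union>x\<in>A. (\<lambda>xs. xs @ [x]) ` permutations_of_set (A - {x}))"
    by (auto simp: permutations_of_set_def)
next
  fix xs assume "xs \<in> (\<Union>x\<in>A. (\<lambda>xs. xs @ [x]) ` permutations_of_set (A - {x}))"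
  then obtain x ys where "x \<in> A" "xs = ys @ [x]" "set ys = A - {x}" "distinct ys"
    unfolding permutations_of_set_def by blast
  then show "xs \<in> permutations_of_set A"
    by (simp add: permutations_of_set_def insert_absorb)
qed

lemma ordering_weight_empty [simp]: "ordering_weight f {} = 1"
  by (simp add: ordering_weight_def)

text \<open>Group the orderings by their last point \<open>x\<close>. The full prefix is
  \<open>A\<close> in each of them, so the factor \<open>1 / f A\<close> is common, and the other
  factors form the product for an ordering of \<open>A - {x}\<close>.\<close>

lemma ordering_weight_rec:
  assumes "finite A" "A \<noteq> {}"
  shows "ordering_weight f A = (\<Sum>x\<in>A. ordering_weight f (A - {x})) / f A"
proof -
  let ?w = "\<lambda>n xs. \<Prod>i=1..n. 1 / f (set (take i xs))"
  have last_factor: "?w (card A) (xs @ [x]) = ?w (card (A - {x})) xs / f A"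
    if "x \<in> A" "xs \<in> permutations_of_set (A - {x})" for x xs
  proof -
    have set_xs: "set xs = A - {x}"
      using that(2) by (rule permutations_of_setD)
    have len: "length xs = card (A - {x})"
      using that(2) by (rule length_finite_permutations_of_set)
    have card: "card A = Suc (card (A - {x}))"
      using card_Suc_Diff1[OF assms(1) that(1)] by (rule sym)
    have "set (take (card A) (xs @ [x])) = A"
      using set_xs len card that(1) by (simp add: insert_absorb del: card_Diff_insert)
    moreover have "?w (card (A - {x})) (xs @ [x]) = ?w (card (A - {x})) xs"
      by (intro prod.cong) (auto simp: len)
    ultimately show ?thesis
      using card by simp
  qed
  \<comment> \<open>The groups are disjoint because the last entry determines
    \<open>x\<close>.\<close>
  have "ordering_weight f A =
      (\<Sum>x\<in>A. \<Sum>xs\<in>(\<lambda>xs. xs @ [x]) ` permutations_of_set (A - {x}). ?w (card A) xs)"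
    unfolding ordering_weight_def permutations_of_set_snoc[OF assms(2)]
    by (intro sum.UNION_disjoint) (use assms in auto)
  also have "\<dots> = (\<Sum>x\<in>A. \<Sum>xs\<in>permutations_of_set (A - {x}). ?w (card A) (xs @ [x]))"
    by (intro sum.cong refl sum.reindex_cong[of "\<lambda>xs. xs @ [_]"]) (auto simp: inj_on_def)
  also have "\<dots> = (\<Sum>x\<in>A. \<Sum>xs\<in>permutations_of_set (A - {x}). ?w (card (A - {x})) xs / f A)"
    by (intro sum.cong refl last_factor)
  finally show ?thesis
    unfolding ordering_weight_def sum_divide_distrib .
qed

section \<open>Log-supermodularity for a submodular rate\<close>

text \<open>The properties of the rate behind log-supermodularity. They are restricted to finite
  subsets of \<open>U\<close> because the neighbourhoods are shown measurable only for finite sets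
  of points over \<open>D\<close>.\<close>

locale submodular_rate =
  fixes U :: "'a set" and f :: "'a set \<Rightarrow> real"
  assumes empty: "f {} = 0"
    and pos: "\<And>A. finite A \<Longrightarrow> A \<subseteq> U \<Longrightarrow> A \<noteq> {} \<Longrightarrow> f A > 0"
    and submodular: "\<And>A B. finite A \<Longrightarrow> finite B \<Longrightarrow> A \<subseteq> U \<Longrightarrow> B \<subseteq> U \<Longrightarrow>
      f (A \<union> B) + f (A \<inter> B) \<le> f A + f B"
begin

abbreviation P :: "'a set \<Rightarrow> real" where "P \<equiv> ordering_weight f"

lemma P_pos:
  assumes "finite A" "A \<subseteq> U"
  shows "P A > 0"
  using assms
proof (induction "card A" arbitrary: A rule: less_induct)
  case less
  show ?case
  proof (cases "A = {}")
    case False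
    have "(\<Sum>x\<in>A. P (A - {x})) > 0"
      using less.prems False
      by (intro sum_pos less.hyps card_Diff1_less) auto
    then show ?thesis
      using less False by (simp add: ordering_weight_rec pos)
  qed simp
qed

text \<open>Clearing the denominator lets the recursion cover \<open>A = {}\<close> as well, where
  both sides vanish.\<close>

lemma P_recursion:
  assumes "finite A" "A \<subseteq> U"
  shows "f A * P A = (\<Sum>x\<in>A. P (A - {x}))"
proof (cases "A = {}")
  case False
  then show ?thesis
    using assms pos[of A] by (simp add: ordering_weight_rec)
qed (simp add: empty)

text \<open>For each \<open>a\<close> in \<open>A\<close>, the induction hypothesis is used at
  \<open>A - {a}\<close> for the pairs \<open>x, y\<close>, then \<open>x, a\<close> and
  \<open>y, a\<close>. The three bounds combine into an inequality linear in the summands of the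
  recursions; summing over \<open>a\<close> turns it into one about \<open>f\<close>.\<close>

lemma P_log_supermodular_local:
  assumes "finite A" "insert x (insert y A) \<subseteq> U" "x \<notin> A" "y \<notin> A" "x \<noteq> y"
  shows "P (insert x A) * P (insert y A) \<le> P (insert x (insert y A)) * P A"
  using assms
proof (induction "card A" arbitrary: A x y rule: less_induct)
  case less
  \<comment> \<open>The letters \<open>x\<close>, \<open>y\<close> in a name are the points added to
    \<open>A\<close>; in the \<open>s\<close> family the point \<open>a\<close> is also
    removed.\<close>
  define r px py pxy where "r = P A" and "px = P (insert x A)" and "py = P (insert y A)"
    and "pxy = P (insert x (insert y A))"
  define s sx sy sxy where "s = (\<lambda>a. P (A - {a}))" and "sx = (\<lambda>a. P (insert x (A - {a})))"
    and "sy = (\<lambda>a. P (insert y (A - {a})))" and "sxy = (\<lambda>a. P (insert x (insert y (A - {a}))))"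
  have diff: "insert z B - {a} = insert z (B - {a})" if "z \<notin> A" "a \<in> A" for z a B
    using that by auto
  have r: "r > 0" and py: "py > 0"
    using less.prems by (auto simp: r_def py_def intro!: P_pos)
  have r_rec: "f A * r = sum s A"
    using less.prems by (simp add: P_recursion r_def s_def)
  have px_rec: "f (insert x A) * px = r + sum sx A"
    using less.prems by (simp add: P_recursion px_def r_def sx_def diff cong: sum.cong)
  have py_rec: "f (insert y A) * py = r + sum sy A"
    using less.prems by (simp add: P_recursion py_def r_def sy_def diff cong: sum.cong)
  have "insert x (insert y A) - {y} = insert x A"
    using less.prems by auto
  then have pxy_rec: "f (insert x (insert y A)) * pxy = py + px + sum sxy A"
    using less.prems
    by (simp add: P_recursion pxy_def py_def px_def sxy_def diff cong: sum.cong)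
  have key: "r * px * sy a + r * py * sx a - px * py * s a \<le> r\<^sup>2 * sxy a" if a: "a \<in> A" for a
  proof -
    have card: "card (A - {a}) < card A"
      using a less.prems by (intro card_Diff1_less)
    have ins: "insert a A = A" and neq: "x \<noteq> a" "y \<noteq> a"
      using a less.prems by auto
    have U: "A - {a} \<subseteq> U" "a \<in> U"
      using a less.prems by auto
    have s: "s a > 0"
      using less.prems by (auto simp: s_def intro!: P_pos)
    have "sx a * sy a \<le> sxy a * s a"
      using less.hyps[OF card, of x y] less.prems U
      by (simp add: s_def sx_def sy_def sxy_def)
    then have xy: "r\<^sup>2 * (sx a * sy a) \<le> r\<^sup>2 * (sxy a * s a)"
      by (intro mult_left_mono) auto
    \<comment> \<open>Inserting \<open>a\<close> into \<open>A - {a}\<close> restores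
      \<open>A\<close>, which brings in \<open>r\<close> and \<open>px\<close>.\<close>
    have x: "sx a * r \<le> px * s a"
      using less.hyps[OF card, of x a] less.prems U neq
      by (simp add: s_def sx_def r_def px_def ins)
    have y: "sy a * r \<le> py * s a"
      using less.hyps[OF card, of y a] less.prems U neq
      by (simp add: s_def sy_def r_def py_def ins)
    \<comment> \<open>Expanding this product leaves the term \<open>r^2 * sx a * sy a\<close>, which
      \<open>xy\<close> bounds; a factor \<open>s a\<close> then cancels.\<close>
    have "0 \<le> (px * s a - sx a * r) * (py * s a - sy a * r)"
      using x y by simp
    with xy have "s a * (r * px * sy a + r * py * sx a - px * py * s a) \<le> s a * (r\<^sup>2 * sxy a)"
      by (simp add: algebra_simps power2_eq_square)
    with s show ?thesis
      by simp
  qed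
  have "r * px * sum sy A + r * py * sum sx A - px * py * sum s A
      = (\<Sum>a\<in>A. r * px * sy a + r * py * sx a - px * py * s a)"
    by (simp add: sum.distrib sum_subtractf sum_distrib_left)
  also have "\<dots> \<le> r\<^sup>2 * sum sxy A"
    unfolding sum_distrib_left by (intro sum_mono key)
  finally have sums: "r * px * sum sy A + r * py * sum sx A - px * py * sum s A
      \<le> r\<^sup>2 * sum sxy A" .
  have sy: "sum sy A = f (insert y A) * py - r" and sx: "sum sx A = f (insert x A) * px - r"
    and sxy: "sum sxy A = f (insert x (insert y A)) * pxy - py - px"
    using px_rec py_rec pxy_rec by auto
  \<comment> \<open>After substitution the terms \<open>r^2 * px\<close> and \<open>r^2 * py\<close>
    occur on both sides and cancel.\<close>
  have "r * (px * py * (f (insert x A) + f (insert y A) - f A))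
      \<le> r * (f (insert x (insert y A)) * (pxy * r))"
    using sums unfolding r_rec[symmetric] sy sx sxy
    by (simp add: algebra_simps power2_eq_square)
  then have upper: "px * py * (f (insert x A) + f (insert y A) - f A)
      \<le> f (insert x (insert y A)) * (pxy * r)"
    using r by simp
  have "insert x A \<union> insert y A = insert x (insert y A)" "insert x A \<inter> insert y A = A"
    using less.prems by auto
  then have "f (insert x (insert y A)) \<le> f (insert x A) + f (insert y A) - f A"
    using submodular[of "insert x A" "insert y A"] less.prems by simp
  moreover have "px * py \<ge> 0"
    using less.prems by (auto simp: px_def py_def intro!: mult_nonneg_nonneg less_imp_le[OF P_pos])
  ultimately have "px * py * f (insert x (insert y A))
      \<le> px * py * (f (insert x A) + f (insert y A) - f A)"
    by (rule mult_left_mono)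
  with upper have "f (insert x (insert y A)) * (px * py) \<le> f (insert x (insert y A)) * (pxy * r)"
    by (simp add: mult.commute)
  moreover have "f (insert x (insert y A)) > 0"
    using less.prems by (intro pos) auto
  ultimately show ?case
    by (simp add: px_def py_def pxy_def r_def)
qed

text \<open>Telescoping: the points of \<open>F\<close> are added one at a time, \<open>G\<close>
  being the part already added, and the one-point inequalities are multiplied. The one-point
  inequality stays a hypothesis so that the argument can be run twice, first with \<open>B\<close>
  one point larger than \<open>A\<close>, then for general \<open>B\<close>.\<close>

lemma P_increment_mono:
  assumes "finite B" "finite F" "B \<subseteq> U" "F \<subseteq> U" "A \<subseteq> B" "F \<inter> B = {}"
    and step: "\<And>x G. x \<in> F \<Longrightarrow> G \<subseteq> F - {x} \<Longrightarrow>
      P (insert x (A \<union> G)) * P (B \<union> G) \<le> P (insert x (B \<union> G)) * P (A \<union> G)"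
  shows "P (A \<union> F) * P B \<le> P (B \<union> F) * P A"
  using assms(2,4,6) step
proof (induction F rule: finite_induct)
  case (insert x F)
  have finA: "finite A"
    using assms finite_subset by blast
  have P: "P A > 0" "P B > 0" "P (A \<union> F) > 0" "P (B \<union> F) > 0"
    "P (insert x (A \<union> F)) > 0" "P (insert x (B \<union> F)) > 0"
    using insert assms finA by (auto intro!: P_pos)
  have "P (A \<union> F) * P B \<le> P (B \<union> F) * P A"
    using insert by (intro insert.IH) auto
  moreover have "P (insert x (A \<union> F)) * P (B \<union> F) \<le> P (insert x (B \<union> F)) * P (A \<union> F)"
    using insert by (intro insert.prems) auto
  ultimately have "(P (A \<union> F) * P B) * (P (insert x (A \<union> F)) * P (B \<union> F))
      \<le> (P (B \<union> F) * P A) * (P (insert x (B \<union> F)) * P (A \<union> F))"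
    by (rule mult_mono) (use P in simp_all)
  then have "(P (A \<union> F) * P (B \<union> F)) * (P (insert x (A \<union> F)) * P B)
      \<le> (P (A \<union> F) * P (B \<union> F)) * (P (insert x (B \<union> F)) * P A)"
    by (simp add: mult_ac)
  then show ?case
    using P by simp
qed simp

lemma P_log_supermodular:
  assumes "finite A" "finite B" "A \<subseteq> U" "B \<subseteq> U"
  shows "P A * P B \<le> P (A \<union> B) * P (A \<inter> B)"
proof -
  \<comment> \<open>First run: the points of \<open>E - C\<close> are added to both \<open>C\<close>
    and \<open>insert x C\<close>, each step being the local inequality.\<close>
  have single: "P (insert x C) * P E \<le> P (insert x E) * P C"
    if "finite E" "insert x E \<subseteq> U" "C \<subseteq> E" "x \<notin> E" for x C E
  proof -
    have fin: "finite C"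
      using that finite_subset by blast
    have "P (C \<union> (E - C)) * P (insert x C) \<le> P (insert x C \<union> (E - C)) * P C"
    proof (rule P_increment_mono)
      fix y G assume "y \<in> E - C" "G \<subseteq> E - C - {y}"
      then show "P (insert y (C \<union> G)) * P (insert x C \<union> G)
          \<le> P (insert y (insert x C \<union> G)) * P (C \<union> G)"
        using P_log_supermodular_local[of "C \<union> G" y x] that fin
        by (auto intro: finite_subset)
    qed (use that fin in auto)
    moreover have "C \<union> (E - C) = E" "insert x C \<union> (E - C) = insert x E"
      using that by auto
    ultimately show ?thesis
      by (simp add: mult.commute)
  qed
  \<comment> \<open>Second run: adding the same points \<open>A - B\<close> leads from
    \<open>A \<inter> B\<close> to \<open>A\<close> and from \<open>B\<close> to
    \<open>A \<union> B\<close>.\<close>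
  have "P (A \<inter> B \<union> (A - B)) * P B \<le> P (B \<union> (A - B)) * P (A \<inter> B)"
  proof (rule P_increment_mono)
    fix x G assume "x \<in> A - B" "G \<subseteq> A - B - {x}"
    then show "P (insert x (A \<inter> B \<union> G)) * P (B \<union> G) \<le> P (insert x (B \<union> G)) * P (A \<inter> B \<union> G)"
      using assms by (intro single) (auto intro: finite_subset)
  qed (use assms in auto)
  moreover have "A \<inter> B \<union> (A - B) = A" "B \<union> (A - B) = A \<union> B"
    by auto
  ultimately show ?thesis
    by simp
qed

text \<open>Split the recursion by whether the removed point lies in \<open>A\<close> or in
  \<open>B\<close>. By induction the two sums are \<open>f A * P A * P B\<close> and
  \<open>P A * (f B * P B)\<close>, so additivity gives the product after cancelling
  \<open>f (A \<union> B)\<close>. Additivity is asked of all subsets because the induction descends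
  to them.\<close>

lemma P_Un_eq_mult:
  assumes "finite A" "finite B" "A \<subseteq> U" "B \<subseteq> U" "A \<inter> B = {}"
    and additive: "\<And>A' B'. A' \<subseteq> A \<Longrightarrow> B' \<subseteq> B \<Longrightarrow> f (A' \<union> B') = f A' + f B'"
  shows "P (A \<union> B) = P A * P B"
  using assms
proof (induction "card A + card B" arbitrary: A B rule: less_induct)
  case less
  show ?case
  proof (cases "A \<union> B = {}")
    case False
    have A: "P (A - {x} \<union> B) = P (A - {x}) * P B" if "x \<in> A" for x
    proof (rule less.hyps)
      fix A' B' assume "A' \<subseteq> A - {x}" "B' \<subseteq> B"
      then show "f (A' \<union> B') = f A' + f B'"
        by (intro less.prems(6)) auto
    qed (use less.prems(1-5) that card_Diff1_less[of A x] in auto)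
    have B: "P (A \<union> (B - {x})) = P A * P (B - {x})" if "x \<in> B" for x
    proof (rule less.hyps)
      fix A' B' assume "A' \<subseteq> A" "B' \<subseteq> B - {x}"
      then show "f (A' \<union> B') = f A' + f B'"
        by (intro less.prems(6)) auto
    qed (use less.prems(1-5) that card_Diff1_less[of B x] in auto)
    have "f (A \<union> B) * P (A \<union> B) = (\<Sum>x\<in>A \<union> B. P (A \<union> B - {x}))"
      using less.prems by (intro P_recursion) auto
    also have "\<dots> = (\<Sum>x\<in>A. P (A \<union> B - {x})) + (\<Sum>x\<in>B. P (A \<union> B - {x}))"
      using less.prems by (intro sum.union_disjoint) auto
    also have "(\<Sum>x\<in>A. P (A \<union> B - {x})) = (\<Sum>x\<in>A. P (A - {x}) * P B)"
    proof (rule sum.cong)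
      fix x assume "x \<in> A"
      moreover from this have "A \<union> B - {x} = A - {x} \<union> B"
        using less.prems by auto
      ultimately show "P (A \<union> B - {x}) = P (A - {x}) * P B"
        by (simp add: A)
    qed simp
    also have "\<dots> = f A * P A * P B"
      using less.prems by (simp add: P_recursion sum_distrib_right)
    also have "(\<Sum>x\<in>B. P (A \<union> B - {x})) = (\<Sum>x\<in>B. P A * P (B - {x}))"
    proof (rule sum.cong)
      fix x assume "x \<in> B"
      moreover from this have "A \<union> B - {x} = A \<union> (B - {x})"
        using less.prems by auto
      ultimately show "P (A \<union> B - {x}) = P A * P (B - {x})"
        by (simp add: B)
    qed simp
    also have "\<dots> = P A * (f B * P B)"
      using less.prems by (simp add: P_recursion sum_distrib_left)
    also have "f A * P A * P B + P A * (f B * P B) = f (A \<union> B) * (P A * P B)"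
      using less.prems(6)[of A B] by (simp add: algebra_simps)
    finally show ?thesis
      using pos[of "A \<union> B"] less.prems False by simp
  qed simp
qed

end

section \<open>Finiteness of the measure and measurability of neighbourhoods\<close>

text \<open>Open sets of finite measure cover the space; a finite subcover and subadditivity bound
  the total mass.\<close>

lemma radon_measure_compact_finite:
  assumes "compact_space X" "radon_measure X m"
  shows "finite_measure m"
proof -
  have sets: "sets m = sigma_sets (topspace X) {U. openin X U}"
    and loc: "\<forall>x\<in>topspace X. \<exists>U. openin X U \<and> x \<in> U \<and> emeasure m U < \<infinity>"
    using assms(2) by (auto simp: radon_measure_def)
  have sp: "space m = topspace X"
  proof -
    have "sets m \<subseteq> Pow (topspace X)"
      unfolding sets using sigma_sets_into_sp[of "{U. openin X U}" "topspace X"] openin_subset by blast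
    moreover have "topspace X \<in> sets m"
      unfolding sets by (rule sigma_sets_top)
    ultimately show ?thesis
      using sets.sets_into_space sets.top by blast
  qed
  let ?\<U> = "{U. openin X U \<and> emeasure m U < \<infinity>}"
  have "topspace X \<subseteq> \<Union> ?\<U>"
    using loc by auto
  then obtain \<F> where \<F>: "finite \<F>" "\<F> \<subseteq> ?\<U>" "topspace X \<subseteq> \<Union> \<F>"
    using assms(1) unfolding compact_space_alt by (metis (no_types, lifting) mem_Collect_eq)
  have \<F>_sets: "\<F> \<subseteq> sets m"
    using \<F>(2) by (auto simp: sets intro: sigma_sets.Basic)
  have "emeasure m (space m) \<le> emeasure m (\<Union> \<F>)"
    using \<F> \<F>_sets sp by (intro emeasure_mono) auto
  also have "\<dots> \<le> (\<Sum>U\<in>\<F>. emeasure m U)"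
    using emeasure_subadditive_finite[of \<F> id m] \<F> \<F>_sets by auto
  also have "\<dots> < \<infinity>"
    using \<F> by (auto simp: less_top)
  finally show ?thesis
    by (intro finite_measureI) auto
qed

text \<open>Makes the counting measure on colours finite, hence also the product measure.\<close>

instance colour :: finite
proof
  have "(UNIV :: colour set) = {Red, Blue}"
    using colour.exhaust by auto
  then show "finite (UNIV :: colour set)"
    by (metis finite.emptyI finite_insert)
qed

lemma finite_measure_coloured_measure:
  assumes "finite_measure m"
  shows "finite_measure (coloured_measure m)"
  unfolding coloured_measure_def
  by (intro finite_measure_pair_measure assms finite_measure_count_space) simp

text \<open>Rectangle form: measurability in the product reduces to that of an open ball.\<close>

lemma nbhd_eq: "nbhd D d x = {q \<in> D. d (fst x) q < 1} \<times> {opp (snd x)}"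
  by (auto simp: nbhd_def)

lemma nbhd_sets_coloured_measure:
  assumes "Metric_space D d" "radon_measure (Metric_space.mtopology D d) m" "x \<in> D \<times> UNIV"
  shows "nbhd D d x \<in> sets (coloured_measure m)"
proof -
  interpret Metric_space D d by fact
  have "{q \<in> D. d (fst x) q < 1} = mball (fst x) 1"
    using assms(3) by (auto simp: mball_def)
  then have "{q \<in> D. d (fst x) q < 1} \<in> sets m"
    using assms(2) by (auto simp: radon_measure_def intro!: sigma_sets.Basic)
  then show ?thesis
    by (simp add: nbhd_eq coloured_measure_def)
qed

section \<open>The concrete rate: submodularity and additivity over colours\<close>

definition match_rate ::
  "'a set \<Rightarrow> ('a \<Rightarrow> 'a \<Rightarrow> real) \<Rightarrow> 'a measure \<Rightarrow> real \<Rightarrow> ('a \<times> colour) set \<Rightarrow> real" where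
  "match_rate D d m \<mu> A = measure (coloured_measure m) (nbhds D d A) + real (card A) * \<mu>"

text \<open>The entries of an ordering are distinct, so the index \<open>i\<close> is the
  cardinality of the prefix and each denominator depends on the prefix only as a set.\<close>

lemma Pi_tilde_eq_ordering_weight: "Pi_tilde D d m \<mu> = ordering_weight (match_rate D d m \<mu>)"
proof
  fix A :: "('a \<times> colour) set"
  have "card (set (take i xs)) = i" if "xs \<in> permutations_of_set A" "i \<le> card A" for i xs
    using that length_finite_permutations_of_set[OF that(1)]
    by (simp add: distinct_card permutations_of_setD)
  then show "Pi_tilde D d m \<mu> A = ordering_weight (match_rate D d m \<mu>) A"
    unfolding Pi_tilde_def ordering_weight_def match_rate_def
    by (intro sum.cong prod.cong) auto
qed

lemma nbhds_Un: "nbhds D d (A \<union> B) = nbhds D d A \<union> nbhds D d B"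
  by (simp add: nbhds_def)

lemma nbhds_sets_coloured_measure:
  assumes "Metric_space D d" "radon_measure (Metric_space.mtopology D d) m"
    "finite A" "A \<subseteq> D \<times> UNIV"
  shows "nbhds D d A \<in> sets (coloured_measure m)"
  unfolding nbhds_def using assms by (intro sets.finite_UN nbhd_sets_coloured_measure) auto

text \<open>The cardinality term is modular, and with \<open>\<mu> > 0\<close> it gives positivity.
  The measure term is submodular by inclusion-exclusion, since \<open>nbhds\<close> commutes with
  unions.\<close>

lemma submodular_rate_match_rate:
  assumes "Metric_space D d" "compact_space (Metric_space.mtopology D d)"
    "radon_measure (Metric_space.mtopology D d) m" "\<mu> > 0"
  shows "submodular_rate (D \<times> UNIV) (match_rate D d m \<mu>)"
proof
  interpret finite_measure "coloured_measure m"
    using assms radon_measure_compact_finite finite_measure_coloured_measure by blast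
  show "match_rate D d m \<mu> {} = 0"
    by (simp add: match_rate_def nbhds_def)
  fix A :: "('a \<times> colour) set"
  assume A: "finite A" "A \<subseteq> D \<times> UNIV"
  show "match_rate D d m \<mu> A > 0" if "A \<noteq> {}"
    unfolding match_rate_def using A that assms(4)
    by (intro add_nonneg_pos mult_pos_pos) (simp_all add: card_gt_0_iff)
  fix B :: "('a \<times> colour) set"
  assume B: "finite B" "B \<subseteq> D \<times> UNIV"
  note [simp] = nbhds_sets_coloured_measure[OF assms(1,3)]
  \<comment> \<open>Only an inclusion: a point may be close to different points of \<open>A\<close>
    and of \<open>B\<close>.\<close>
  have int: "nbhds D d (A \<inter> B) \<subseteq> nbhds D d A \<inter> nbhds D d B"
    by (auto simp: nbhds_def)
  have "measure (coloured_measure m) (nbhds D d (A \<inter> B))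
      \<le> measure (coloured_measure m) (nbhds D d A \<inter> nbhds D d B)"
    using A B by (intro finite_measure_mono int sets.Int) simp_all
  moreover have "measure (coloured_measure m) (nbhds D d A \<union> nbhds D d B)
      + measure (coloured_measure m) (nbhds D d A \<inter> nbhds D d B)
      = measure (coloured_measure m) (nbhds D d A) + measure (coloured_measure m) (nbhds D d B)"
    using A B by (simp add: measure_Un3 fmeasurable_eq_sets)
  moreover have "real (card (A \<union> B)) * \<mu> + real (card (A \<inter> B)) * \<mu>
      = real (card A) * \<mu> + real (card B) * \<mu>"
    using card_Un_Int[OF A(1) B(1)] by (simp flip: distrib_right of_nat_add)
  ultimately show "match_rate D d m \<mu> (A \<union> B) + match_rate D d m \<mu> (A \<inter> B)
      \<le> match_rate D d m \<mu> A + match_rate D d m \<mu> B"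
    by (simp add: match_rate_def nbhds_Un)
qed

text \<open>Neighbours of red points are blue and conversely, so no mass is counted twice. This
  supplies the additivity for the factorisation over colours.\<close>

lemma match_rate_Un_opposite:
  assumes "Metric_space D d" "compact_space (Metric_space.mtopology D d)"
    "radon_measure (Metric_space.mtopology D d) m"
    and A: "finite A" "A \<subseteq> D \<times> {Red}" and B: "finite B" "B \<subseteq> D \<times> {Blue}"
  shows "match_rate D d m \<mu> (A \<union> B) = match_rate D d m \<mu> A + match_rate D d m \<mu> B"
proof -
  interpret finite_measure "coloured_measure m"
    using assms radon_measure_compact_finite finite_measure_coloured_measure by blast
  have "nbhds D d A \<inter> nbhds D d B = {}"
    using A B by (fastforce simp: nbhds_def nbhd_def)
  moreover have "nbhds D d A \<in> sets (coloured_measure m)" "nbhds D d B \<in> sets (coloured_measure m)"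
    using A B by (auto intro!: nbhds_sets_coloured_measure[OF assms(1,3)])
  moreover have "card (A \<union> B) = card A + card B"
    using A B by (intro card_Un_disjoint) auto
  ultimately show ?thesis
    by (simp add: match_rate_def nbhds_Un finite_measure_Union algebra_simps)
qed

theorem corollary2p10:
  fixes D :: "'a set" and d :: "'a \<Rightarrow> 'a \<Rightarrow> real" and m :: "'a measure" and \<mu> :: real
    and \<xi> \<gamma> :: "('a \<times> colour) set"
  assumes "Metric_space D d"
    and "compact_space (Metric_space.mtopology D d)"
    and "radon_measure (Metric_space.mtopology D d) m"
    and "\<mu> > 0"
    and "finite \<xi>" and "\<xi> \<subseteq> D \<times> UNIV"
    and "finite \<gamma>" and "\<gamma> \<subseteq> D \<times> UNIV"
  shows "Pi_tilde D d m \<mu> (config_join \<xi> \<gamma>) * Pi_tilde D d m \<mu> (config_meet \<xi> \<gamma>)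
           \<ge> Pi_tilde D d m \<mu> \<xi> * Pi_tilde D d m \<mu> \<gamma>"
proof -
  interpret submodular_rate "D \<times> UNIV" "match_rate D d m \<mu>"
    by (rule submodular_rate_match_rate) fact+
  define R B :: "('a \<times> colour) set \<Rightarrow> ('a \<times> colour) set"
    where "R = points_of_colour Red" and "B = points_of_colour Blue"
  have split: "P (X \<union> Y) = P X * P Y"
    if "finite X" "X \<subseteq> D \<times> {Red}" "finite Y" "Y \<subseteq> D \<times> {Blue}" for X Y
  proof (rule P_Un_eq_mult)
    fix X' Y' assume "X' \<subseteq> X" "Y' \<subseteq> Y"
    with that show "match_rate D d m \<mu> (X' \<union> Y') = match_rate D d m \<mu> X' + match_rate D d m \<mu> Y'"
      using assms(1-3) by (intro match_rate_Un_opposite) (auto intro: finite_subset)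
  qed (use that in auto)
  have fin: "finite (R \<xi>)" "finite (R \<gamma>)" "finite (B \<xi>)" "finite (B \<gamma>)"
    using assms by (auto simp: R_def B_def points_of_colour_def)
  have R: "R \<xi> \<subseteq> D \<times> {Red}" "R \<gamma> \<subseteq> D \<times> {Red}"
    and B: "B \<xi> \<subseteq> D \<times> {Blue}" "B \<gamma> \<subseteq> D \<times> {Blue}"
    using assms by (auto simp: R_def B_def points_of_colour_def)
  have decomp: "R X \<union> B X = X" for X :: "('a \<times> colour) set"
    using colour.exhaust by (auto simp: R_def B_def points_of_colour_def)
  have "P \<xi> * P \<gamma> = (P (R \<xi>) * P (B \<xi>)) * (P (R \<gamma>) * P (B \<gamma>))"
    using split[of "R \<xi>" "B \<xi>"] split[of "R \<gamma>" "B \<gamma>"] fin R B by (simp add: decomp)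
  also have "\<dots> = (P (R \<xi>) * P (R \<gamma>)) * (P (B \<xi>) * P (B \<gamma>))"
    by (simp add: mult_ac)
  \<comment> \<open>Log-supermodularity for inclusion is applied to each colour separately.\<close>
  also have "\<dots> \<le> (P (R \<xi> \<union> R \<gamma>) * P (R \<xi> \<inter> R \<gamma>)) * (P (B \<xi> \<union> B \<gamma>) * P (B \<xi> \<inter> B \<gamma>))"
    using fin R B
    by (intro mult_mono P_log_supermodular mult_nonneg_nonneg less_imp_le[OF P_pos]) auto
  \<comment> \<open>The order of configurations is reversed on blue points; as each bound is a
    product over union and intersection, regrouping the factors accounts for this.\<close>
  also have "\<dots> = (P (R \<xi> \<union> R \<gamma>) * P (B \<xi> \<inter> B \<gamma>)) * (P (R \<xi> \<inter> R \<gamma>) * P (B \<xi> \<union> B \<gamma>))"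
    by (simp add: mult_ac)
  also have "P (R \<xi> \<union> R \<gamma>) * P (B \<xi> \<inter> B \<gamma>) = P (config_join \<xi> \<gamma>)"
    using fin R B unfolding config_join_def R_def[symmetric] B_def[symmetric]
    by (intro split[symmetric]) auto
  also have "P (R \<xi> \<inter> R \<gamma>) * P (B \<xi> \<union> B \<gamma>) = P (config_meet \<xi> \<gamma>)"
    using fin R B unfolding config_meet_def R_def[symmetric] B_def[symmetric]
    by (intro split[symmetric]) auto
  finally show ?thesis
    unfolding Pi_tilde_eq_ordering_weight .
qed

end
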